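(* Let $\mathcal{X}$ be a linear vector field on $SU(2)$ with linear flow $\varphi_t$, and let $X$ be the right invariant vector field associated to $\mathcal{X}$, given by $$X=\begin{pmatrix}\frac{i}{2}x&\frac12(iz+y)\\ \frac12(iz-y)&-\frac{i}{2}x\end{pmatrix}\in\mathfrak{su}(2),\qquad x,y,z\in\mathbb{R}.$$ Then: (i) every orbit of the invariant flow $\exp(tX)$ that is not a fixed point is periodic; (ii) every orbit of the linear flow $\varphi_t$ that is not a fixed point is periodic. Furthermore, the period is $T=2\pi/\sqrt{x^2+y^2+z^2}$.
   Context: $SU(2)$ is the group of $2\times2$ complex unitary matrices with determinant $1$. A vector field $\mathcal{X}$ on a Lie group $G$ is called linear if its flow $(\varphi_t)_{t\in\mathbb{R}}$ is a family of automorphisms of the Lie group $G$; $\varphi_t$ is then called the linear flow. For semisimple $G$ there is a right invariant vector field $X$ (identified with an element of the Lie algebra) such that $\mathcal{X}=X+I_*X$, where $I_*$ is the differential of the inversion $g\mapsto g^{-1}$; equivalently $\varphi_t(g)=\exp(tX)\,g\,\exp(-tX)$. The invariant flow of $X$ is $g\mapsto\exp(tX)g$. An orbit is periodic if its orbit curve $c$ satisfies $c(t+s)=c(t)$ for all $t\in\mathbb{R}$, for some $s>0$.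
   Formalization: The period T=2π/√(x²+y²+z²) is asserted (as least period) only for the linear flow in (ii); for the invariant flow in (i) it is false, since exp(TX)=−I for every nonzero X, so there only periodicity is stated. *)

theory Defs
  imports "HOL-Analysis.Analysis" "HOL-Algebra.Group"
begin

section \<open>Smooth maps and vector fields on subsets of a normed space\<close>

text \<open>
  $SU(2)$ is treated as an embedded submanifold of the space of complex $2 \times 2$ matrices
  (a real normed vector space of dimension 8). Smoothness on a subset means local extendability
  to a smooth map on an open set, and tangent vectors are velocities of curves in the subset,
  the usual descriptions for embedded submanifolds.
\<close>

primrec Ck_on_open ::
  "nat \<Rightarrow> 'a::real_normed_vector set \<Rightarrow> ('a \<Rightarrow> 'b::real_normed_vector) \<Rightarrow> bool" where
  "Ck_on_open 0 U f \<longleftrightarrow> continuous_on U f"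
| "Ck_on_open (Suc k) U f \<longleftrightarrow>
     (\<forall>p\<in>U. f differentiable (at p)) \<and>
     (\<forall>v. Ck_on_open k U (\<lambda>p. frechet_derivative f (at p) v))"

definition smooth_map_on ::
  "'a::real_normed_vector set \<Rightarrow> ('a \<Rightarrow> 'b::real_normed_vector) \<Rightarrow> bool" where
  "smooth_map_on S f \<longleftrightarrow>
     (\<forall>p\<in>S. \<exists>U F. open U \<and> p \<in> U \<and> (\<forall>k. Ck_on_open k U F) \<and> (\<forall>q\<in>S \<inter> U. F q = f q))"

definition tangent_space :: "'a::real_normed_vector set \<Rightarrow> 'a \<Rightarrow> 'a set" where
  "tangent_space S p =
     {v. \<exists>c :: real \<Rightarrow> 'a. c 0 = p \<and> (\<forall>t. c t \<in> S) \<and> (c has_vector_derivative v) (at 0)}"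

definition vector_field_on :: "'a::real_normed_vector set \<Rightarrow> ('a \<Rightarrow> 'a) \<Rightarrow> bool" where
  "vector_field_on S V \<longleftrightarrow> smooth_map_on S V \<and> (\<forall>p\<in>S. V p \<in> tangent_space S p)"

definition flow_of ::
  "'a::real_normed_vector set \<Rightarrow> ('a \<Rightarrow> 'a) \<Rightarrow> (real \<Rightarrow> 'a \<Rightarrow> 'a) \<Rightarrow> bool" where
  "flow_of S V \<phi> \<longleftrightarrow>
     (\<forall>p\<in>S. \<phi> 0 p = p \<and>
       (\<forall>t. \<phi> t p \<in> S \<and> ((\<lambda>s. \<phi> s p) has_vector_derivative V (\<phi> t p)) (at t)))"


section \<open>The Lie group SU(2)\<close>

definition adjoint_mat :: "complex^'n^'m \<Rightarrow> complex^'m^'n" where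
  "adjoint_mat A = (\<chi> i j. cnj (A $ j $ i))"

definition SU2 :: "(complex^2^2) monoid" where
  "SU2 = \<lparr>carrier = {U. adjoint_mat U ** U = mat 1 \<and> U ** adjoint_mat U = mat 1 \<and> det U = 1},
          mult = (**), one = mat 1\<rparr>"

definition lie_automorphism ::
  "('a::real_normed_vector) monoid \<Rightarrow> ('a \<Rightarrow> 'a) \<Rightarrow> bool" where
  "lie_automorphism G f \<longleftrightarrow>
     f \<in> iso G G \<and> smooth_map_on (carrier G) f \<and>
     smooth_map_on (carrier G) (inv_into (carrier G) f)"

definition linear_vector_field_with_flow ::
  "('a::real_normed_vector) monoid \<Rightarrow> ('a \<Rightarrow> 'a) \<Rightarrow> (real \<Rightarrow> 'a \<Rightarrow> 'a) \<Rightarrow> bool" where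
  "linear_vector_field_with_flow G V \<phi> \<longleftrightarrow>
     vector_field_on (carrier G) V \<and> flow_of (carrier G) V \<phi> \<and> (\<forall>t. lie_automorphism G (\<phi> t))"

text \<open>The right translation by $g$ is linear in the matrix entries, so its differential maps
  the Lie algebra element $A$ to $A g$.\<close>

definition right_invariant_field :: "complex^'n^'n \<Rightarrow> complex^'n^'n \<Rightarrow> complex^'n^'n" where
  "right_invariant_field A g = A ** g"

text \<open>The push-forward $(I_* V)(g) = dI_{I^{-1}(g)}(V(I^{-1}(g)))$ under the inversion
  $I = I^{-1}$. The differential of $I$ on the group is the restriction to tangent vectors
  of the derivative of inversion on the open set of all invertible matrices.\<close>

definition inversion_pushforward ::
  "(complex^'n^'n \<Rightarrow> complex^'n^'n) \<Rightarrow> complex^'n^'n \<Rightarrow> complex^'n^'n" where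
  "inversion_pushforward V g =
     frechet_derivative matrix_inv (at (matrix_inv g)) (V (matrix_inv g))"

definition associated_field ::
  "(complex^2^2 \<Rightarrow> complex^2^2) \<Rightarrow> complex^2^2 \<Rightarrow> bool" where
  "associated_field V A \<longleftrightarrow>
     (\<forall>g\<in>carrier SU2. V g =
        right_invariant_field A g + inversion_pushforward (right_invariant_field A) g)"

text \<open>The type of square matrices is not an instance of the class required by \<^const>\<open>exp\<close>
  (its multiplication \<^term>\<open>(*)\<close> is entrywise), hence the power series is written out.\<close>

definition mat_exp :: "complex^'n^'n \<Rightarrow> complex^'n^'n" where
  "mat_exp A = (\<Sum>k. (1 / fact k) *\<^sub>R (((**) A ^^ k) (mat 1)))"

definition invariant_flow :: "complex^'n^'n \<Rightarrow> real \<Rightarrow> complex^'n^'n \<Rightarrow> complex^'n^'n" where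
  "invariant_flow A t g = mat_exp (t *\<^sub>R A) ** g"

definition su2_matrix :: "real \<Rightarrow> real \<Rightarrow> real \<Rightarrow> complex^2^2" where
  "su2_matrix x y z =
     vector [vector [\<i> / 2 * of_real x, 1 / 2 * (\<i> * of_real z + of_real y)],
             vector [1 / 2 * (\<i> * of_real z - of_real y), - (\<i> / 2) * of_real x]]"


section \<open>Periodic orbits\<close>

definition fixed_point :: "(real \<Rightarrow> 'a \<Rightarrow> 'a) \<Rightarrow> 'a \<Rightarrow> bool" where
  "fixed_point \<phi> p \<longleftrightarrow> (\<forall>t. \<phi> t p = p)"

definition orbit_curve :: "(real \<Rightarrow> 'a \<Rightarrow> 'a) \<Rightarrow> 'a \<Rightarrow> real \<Rightarrow> 'a" where
  "orbit_curve \<phi> p t = \<phi> t p"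

definition periodic_curve :: "(real \<Rightarrow> 'a) \<Rightarrow> bool" where
  "periodic_curve c \<longleftrightarrow> (\<exists>s>0. \<forall>t. c (t + s) = c t)"

text \<open>``The period'' of a curve is its least positive period.\<close>

definition has_period :: "(real \<Rightarrow> 'a) \<Rightarrow> real \<Rightarrow> bool" where
  "has_period c T \<longleftrightarrow>
     T > 0 \<and> (\<forall>t. c (t + T) = c t) \<and> (\<forall>s>0. (\<forall>t. c (t + s) = c t) \<longrightarrow> T \<le> s)"

end

theory Submission
  imports Defs
begin

text \<open>
  Since \<open>X\<^sup>2 = - \<omega>\<^sup>2 I\<close> with \<open>\<omega> = sqrt (x\<^sup>2 + y\<^sup>2 + z\<^sup>2) / 2\<close>, we have
  \<open>exp (t X) = cos (\<omega> t) I + (sin (\<omega> t) / \<omega>) X\<close>, which has period \<open>2 \<pi> / \<omega>\<close> and changes sign after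
  time \<open>\<pi> / \<omega>\<close>. The linear field is \<open>g \<mapsto> X g - g X\<close>, so its flow is conjugation by \<open>exp (t X)\<close>.
  The sign cancels there, leaving the period \<open>\<pi> / \<omega>\<close>. It is the least one, because \<open>exp (s X)\<close>
  commutes with a \<open>g\<close> that does not commute with \<open>X\<close> only if \<open>sin (\<omega> s) = 0\<close>.
\<close>

section \<open>Bilinearity of the matrix product\<close>

lemma bounded_bilinear_matrix_matrix_mult:
  "bounded_bilinear ((**) :: complex^'n^'m \<Rightarrow> complex^'p^'n \<Rightarrow> complex^'p^'m)"
  unfolding bilinear_conv_bounded_bilinear[symmetric] bilinear_def linear_iff
  by (auto simp: matrix_matrix_mult_def vec_eq_iff sum.distrib algebra_simps scaleR_sum_right)

interpretation mmult: bounded_bilinear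
  "(**) :: complex^'n^'m \<Rightarrow> complex^'p^'n \<Rightarrow> complex^'p^'m"
  by (rule bounded_bilinear_matrix_matrix_mult)

lemma bounded_linear_mat: "bounded_linear (mat :: complex \<Rightarrow> complex^'n^'n)"
  unfolding linear_conv_bounded_linear[symmetric] linear_iff
  by (auto simp: mat_def vec_eq_iff)

section \<open>Matrix inversion, its derivative and the push-forward under it\<close>

lemma matrix_inv_eq:
  fixes M N :: "complex^'n^'n"
  assumes "M ** N = mat 1"
  shows "matrix_inv M = N"
  unfolding matrix_inv_def
proof (rule some_equality)
  show "M ** N = mat 1 \<and> N ** M = mat 1"
    using assms by (simp add: matrix_left_right_inverse)
  show "L = N" if "M ** L = mat 1 \<and> L ** M = mat 1" for L
    using assms that by (metis matrix_mul_assoc matrix_mul_lid matrix_mul_rid)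
qed

lemma matrix_mul_matrix_inv:
  fixes M :: "complex^'n^'n"
  assumes "det M \<noteq> 0"
  shows "M ** matrix_inv M = mat 1" "matrix_inv M ** M = mat 1"
proof -
  obtain N where "M ** N = mat 1"
    using assms by (auto simp: invertible_det_nz[symmetric] invertible_right_inverse)
  then show "M ** matrix_inv M = mat 1"
    by (simp add: matrix_inv_eq)
  then show "matrix_inv M ** M = mat 1"
    by (simp add: matrix_left_right_inverse)
qed

text \<open>\<open>mat (trace M) - M\<close> is the adjugate of a 2 x 2 matrix. In this form the
  inverse is visibly differentiable in the entries.\<close>

lemma matrix_inv_2:
  fixes M :: "complex^2^2"
  assumes "det M \<noteq> 0"
  shows "matrix_inv M = mat (1 / det M) ** (mat (trace M) - M)"
proof (rule matrix_inv_eq)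
  have "M ** (mat (1 / det M) ** (mat (trace M) - M)) =
      mat (1 / det M) ** (M ** (mat (trace M) - M))"
    by (simp add: vec_eq_iff forall_2 matrix_matrix_mult_def mat_def sum_2 algebra_simps)
  also have "M ** (mat (trace M) - M) = mat (det M)" \<comment> \<open>Cayley--Hamilton\<close>
    by (simp add: vec_eq_iff forall_2 matrix_matrix_mult_def mat_def trace_def sum_2 det_2
        algebra_simps)
  also have "mat (1 / det M) ** mat (det M) = (mat 1 :: complex^2^2)"
    using assms by (simp add: vec_eq_iff forall_2 matrix_matrix_mult_def mat_def sum_2)
  finally show "M ** (mat (1 / det M) ** (mat (trace M) - M)) = mat 1" .
qed

text \<open>Differentiability is read off the adjugate formula; the value then follows from the
  product rule applied to \<open>N ** matrix_inv N\<close>.\<close>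

lemma frechet_derivative_matrix_inv:
  fixes M :: "complex^2^2"
  assumes "det M \<noteq> 0"
  shows "frechet_derivative matrix_inv (at M) H = - (matrix_inv M ** H ** matrix_inv M)"
proof -
  let ?F = "\<lambda>M::complex^2^2. mat (1 / det M) ** (mat (trace M) - M)"
  let ?U = "{M::complex^2^2. det M \<noteq> 0}"
  have "open ?U"
    unfolding det_2 by (intro open_Collect_neq continuous_intros)
  have "?F differentiable (at M)"
  proof -
    have nth: "(\<lambda>M::complex^2^2. M $ i $ j) differentiable (at M)" for i j
      by (intro bounded_linear_imp_differentiable bounded_linear_compose[OF bounded_linear_vec_nth]
          bounded_linear_vec_nth)
    have "(\<lambda>M::complex^2^2. 1 / det M) differentiable (at M)"
      using assms unfolding det_2 
      by (intro differentiable_divide differentiable_diff differentiable_mult nth) auto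
    then obtain a where a: "((\<lambda>M::complex^2^2. 1 / det M) has_derivative a) (at M)"
      by (auto simp: differentiable_def)
    have "(\<lambda>M::complex^2^2. trace M) differentiable (at M)"
      unfolding trace_def sum_2 by (intro differentiable_add nth)
    then obtain b where b: "((\<lambda>M::complex^2^2. trace M) has_derivative b) (at M)"
      by (auto simp: differentiable_def)
    show ?thesis
      unfolding differentiable_def
      by (rule exI, rule mmult.FDERIV[OF bounded_linear.has_derivative[OF bounded_linear_mat a]
            has_derivative_diff[OF bounded_linear.has_derivative[OF bounded_linear_mat b]
              has_derivative_ident]])
  qed
  then obtain D where "(?F has_derivative D) (at M)"
    by (auto simp: differentiable_def)
  \<comment> \<open>The formula agrees with \<open>matrix_inv\<close> on the open set
    \<open>?U\<close>, which suffices for the derivative at \<open>M\<close>.\<close>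
  then have D: "(matrix_inv has_derivative D) (at M)"
    by (rule has_derivative_transform_within_open[OF _ \<open>open ?U\<close>])
      (simp_all add: assms matrix_inv_2)
  have "((\<lambda>N. N ** matrix_inv N) has_derivative (\<lambda>H. M ** D H + H ** matrix_inv M)) (at M)"
    by (rule mmult.FDERIV[OF has_derivative_ident D])
  \<comment> \<open>The same product is constant near \<open>M\<close>, so the expression from the
    product rule must vanish.\<close>
  moreover have "((\<lambda>N. N ** matrix_inv N) has_derivative (\<lambda>H. 0)) (at M)"
    by (rule has_derivative_transform_within_open[OF has_derivative_const[of "mat 1"] \<open>open ?U\<close>])
      (simp_all add: assms matrix_mul_matrix_inv(1))
  ultimately have "(\<lambda>H. M ** D H + H ** matrix_inv M) = (\<lambda>H. 0)"
    by (rule has_derivative_unique)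
  then have "M ** D H + H ** matrix_inv M = 0"
    by (rule fun_cong)
  then have "M ** D H = - (H ** matrix_inv M)"
    by (simp add: eq_neg_iff_add_eq_0)
  then have "matrix_inv M ** (M ** D H) = - (matrix_inv M ** H ** matrix_inv M)"
    by (simp add: mmult.minus_right matrix_mul_assoc)
  moreover have "matrix_inv M ** (M ** D H) = D H"
    using matrix_mul_matrix_inv(2)[OF assms] by (simp add: matrix_mul_assoc)
  ultimately show ?thesis
    using frechet_derivative_at[OF D] by simp
qed

text \<open>The push-forward differentiates inversion at the inverse \<open>h\<close> of
  \<open>g\<close>, where the inverse is \<open>g\<close> again; the factor \<open>h\<close> of the
  field cancels against one \<open>g\<close> and leaves \<open>- (g ** A)\<close>.\<close>

lemma associated_field_eq_commutator:
  assumes "associated_field V A" and g: "g \<in> carrier SU2"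
  shows "V g = A ** g - g ** A"
proof -
  define h where "h = adjoint_mat g"
  have gh: "g ** h = mat 1" "h ** g = mat 1"
    using g by (auto simp: SU2_def h_def)
  have "det h * det g = 1"
    using gh(2) by (simp flip: det_mul)
  then have "det h \<noteq> 0" by auto
  have "inversion_pushforward (right_invariant_field A) g = - (g ** (A ** h) ** g)"
    unfolding inversion_pushforward_def right_invariant_field_def matrix_inv_eq[OF gh(1)]
      frechet_derivative_matrix_inv[OF \<open>det h \<noteq> 0\<close>] matrix_inv_eq[OF gh(2)] ..
  also have "\<dots> = - (g ** A)"
    by (simp add: gh(2) flip: matrix_mul_assoc)
  finally show ?thesis
    using assms by (simp add: associated_field_def right_invariant_field_def)
qed

section \<open>Closed form of the exponential when \<open>A\<close> squares to a negative
  scalar\<close>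

definition rotor :: "real \<Rightarrow> complex^'n^'n \<Rightarrow> real \<Rightarrow> complex^'n^'n" where
  "rotor \<omega> A t = cos (\<omega> * t) *\<^sub>R mat 1 + (sin (\<omega> * t) / \<omega>) *\<^sub>R A"

text \<open>The powers of \<open>A\<close> alternate between multiples of the identity and of
  \<open>A\<close>, so the series splits into those of cosine and sine.\<close>

lemma mat_exp_eq_rotor:
  fixes A :: "complex^'n^'n"
  assumes A: "A ** A = - (\<omega>\<^sup>2 *\<^sub>R mat 1)" and \<omega>: "\<omega> \<noteq> 0"
  shows "mat_exp (t *\<^sub>R A) = rotor \<omega> A t"
proof -
  \<comment> \<open>For each \<open>k\<close> one of \<open>cos_coeff k\<close> and
    \<open>sin_coeff k\<close> is zero, so one formula serves both parities.\<close>
  have pow: "((**) (t *\<^sub>R A) ^^ k) (mat 1) =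
      fact k *\<^sub>R ((cos_coeff k * (\<omega> * t) ^ k) *\<^sub>R mat 1
        + (sin_coeff k * (\<omega> * t) ^ k / \<omega>) *\<^sub>R A)" for k
  proof (induction k)
    case (Suc k)
    have f: "fact (Suc k) * (u / real (Suc k)) = fact k * u" for u :: real
      by (simp add: field_simps)
    have "((**) (t *\<^sub>R A) ^^ Suc k) (mat 1) =
      (fact k * (cos_coeff k * (\<omega> * t) ^ k) * t) *\<^sub>R A
      + (- (fact k * (sin_coeff k * (\<omega> * t) ^ k / \<omega>) * t * \<omega>\<^sup>2)) *\<^sub>R mat 1"
      by (simp add: Suc.IH mmult.scaleR_left mmult.scaleR_right mmult.add_right A scaleR_right_distrib
          mult_ac)
    \<comment> \<open>Another factor \<open>A\<close> swaps the two components, just as the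
      recursions of \<open>cos_coeff\<close> and \<open>sin_coeff\<close> swap cosine and
      sine.\<close>
    also have "- (fact k * (sin_coeff k * (\<omega> * t) ^ k / \<omega>) * t * \<omega>\<^sup>2) =
      fact (Suc k) * (cos_coeff (Suc k) * (\<omega> * t) ^ Suc k)"
      using \<omega> f[of "- sin_coeff k * (\<omega> * t) ^ Suc k"]
      by (simp add: cos_coeff_Suc power2_eq_square mult_ac)
    also have "fact k * (cos_coeff k * (\<omega> * t) ^ k) * t =
      fact (Suc k) * (sin_coeff (Suc k) * (\<omega> * t) ^ Suc k / \<omega>)"
      using \<omega> f[of "cos_coeff k * (\<omega> * t) ^ Suc k / \<omega>"]
      by (simp add: sin_coeff_Suc power2_eq_square mult_ac)
    finally show ?case by (simp add: scaleR_right_distrib add.commute)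
  qed simp
  have "(\<lambda>k. (cos_coeff k * (\<omega> * t) ^ k) *\<^sub>R mat 1 + (sin_coeff k * (\<omega> * t) ^ k / \<omega>) *\<^sub>R A)
    sums rotor \<omega> A t"
    unfolding rotor_def
    using cos_converges[of "\<omega> * t"] sin_converges[of "\<omega> * t"]
    by (intro sums_add bounded_linear.sums[OF bounded_linear_scaleR_left] sums_divide) auto
  then show ?thesis
    unfolding mat_exp_def pow by (simp add: sums_iff)
qed

text \<open>Serves the case of the zero matrix, which \<open>mat_exp_eq_rotor\<close> excludes by
  \<omega> \<noteq> 0.\<close>

lemma mat_exp_0: "mat_exp (0 :: complex^'n^'n) = mat 1"
proof -
  have "(1 / fact k) *\<^sub>R ((**) (0 :: complex^'n^'n) ^^ k) (mat 1) = (if k = 0 then mat 1 else 0)" for k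
    by (cases k) auto
  then show ?thesis
    unfolding mat_exp_def by (simp add: sums_single[THEN sums_unique, symmetric])
qed

lemma rotor_0 [simp]: "rotor \<omega> A 0 = mat 1"
  by (simp add: rotor_def)

lemma rotor_commute: "rotor \<omega> A t ** A = A ** rotor \<omega> A t"
  by (simp add: rotor_def mmult.add_left mmult.add_right mmult.scaleR_left mmult.scaleR_right)

lemma rotor_add:
  assumes A: "A ** A = - (\<omega>\<^sup>2 *\<^sub>R mat 1)" and \<omega>: "\<omega> \<noteq> 0"
  shows "rotor \<omega> A (s + t) = rotor \<omega> A s ** rotor \<omega> A t"
proof -
  have "rotor \<omega> A s ** rotor \<omega> A t =
    (cos (\<omega> * s) * cos (\<omega> * t) - sin (\<omega> * s) / \<omega> * (sin (\<omega> * t) / \<omega>) * \<omega>\<^sup>2) *\<^sub>R mat 1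
    + (sin (\<omega> * s) / \<omega> * cos (\<omega> * t) + cos (\<omega> * s) * (sin (\<omega> * t) / \<omega>)) *\<^sub>R A"
    by (simp add: rotor_def mmult.add_left mmult.add_right mmult.scaleR_left mmult.scaleR_right A
        scaleR_left_distrib scaleR_left_diff_distrib scaleR_right_distrib scaleR_right_diff_distrib
        mult_ac)
  also have "\<dots> = rotor \<omega> A (s + t)"
    using \<omega> by (simp add: rotor_def distrib_left cos_add sin_add power2_eq_square add_divide_distrib)
  finally show ?thesis ..
qed

lemma rotor_minus:
  assumes "A ** A = - (\<omega>\<^sup>2 *\<^sub>R mat 1)" and "\<omega> \<noteq> 0"
  shows "rotor \<omega> A (- t) ** rotor \<omega> A t = mat 1" "rotor \<omega> A t ** rotor \<omega> A (- t) = mat 1"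
  using rotor_add[OF assms, of "- t" t] rotor_add[OF assms, of t "- t"] by simp_all

section \<open>The commutator equation and its solution\<close>

lemma rotor_has_vector_derivative:
  assumes A: "A ** A = - (\<omega>\<^sup>2 *\<^sub>R mat 1)" and \<omega>: "\<omega> \<noteq> 0"
  shows "(rotor \<omega> A has_vector_derivative A ** rotor \<omega> A t) (at t)"
proof -
  have 1: "((\<lambda>t. cos (\<omega> * t)) has_real_derivative - sin (\<omega> * t) * \<omega>) (at t)"
    by (auto intro!: derivative_eq_intros)
  have 2: "((\<lambda>t. sin (\<omega> * t) / \<omega>) has_real_derivative cos (\<omega> * t)) (at t)"
    using \<omega> by (auto intro!: derivative_eq_intros)
  have "((\<lambda>t. cos (\<omega> * t) *\<^sub>R mat 1 + (sin (\<omega> * t) / \<omega>) *\<^sub>R A) has_vector_derivative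
     (cos (\<omega> * t) *\<^sub>R 0 + (- sin (\<omega> * t) * \<omega>) *\<^sub>R mat 1) +
     ((sin (\<omega> * t) / \<omega>) *\<^sub>R 0 + cos (\<omega> * t) *\<^sub>R A)) (at t)"
    by (intro has_vector_derivative_add has_vector_derivative_scaleR 1 2 has_vector_derivative_const)
  moreover have "A ** rotor \<omega> A t = (- sin (\<omega> * t) * \<omega>) *\<^sub>R mat 1 + cos (\<omega> * t) *\<^sub>R A"
    using \<omega> by (simp add: rotor_def mmult.add_right mmult.scaleR_right A power2_eq_square)
  ultimately show ?thesis
    by (simp add: rotor_def[abs_def])
qed

text \<open>Conjugating a solution back by the rotor gives a curve \<open>d\<close> with zero
  derivative, hence a constant one.\<close>

lemma commutator_ode_solution:
  fixes A :: "complex^'n^'n"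
  assumes A: "A ** A = - (\<omega>\<^sup>2 *\<^sub>R mat 1)" and \<omega>: "\<omega> \<noteq> 0"
    and c: "\<And>t. (c has_vector_derivative A ** c t - c t ** A) (at t)"
  shows "c t = rotor \<omega> A t ** c 0 ** rotor \<omega> A (- t)"
proof -
  let ?E = "rotor \<omega> A"
  define d where "d t = ?E (- t) ** c t ** ?E t" for t
  have minus: "((\<lambda>t. ?E (- t)) has_vector_derivative - (A ** ?E (- t))) (at t)" for t
  proof -
    have "((\<lambda>t. - t) has_vector_derivative - 1) (at t)"
      by (auto intro!: derivative_eq_intros)
    from vector_diff_chain_at[OF this rotor_has_vector_derivative[OF A \<omega>]]
    show ?thesis by (simp add: o_def)
  qed
  have "(d has_vector_derivative 0) (at t)" for t
    using mmult.has_vector_derivative[OF mmult.has_vector_derivative[OF minus c]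
        rotor_has_vector_derivative[OF A \<omega>], of t]
    by (simp add: d_def[abs_def] mmult.add_left mmult.minus_left mmult.diff_right mmult.diff_left
        matrix_mul_assoc rotor_commute)
  then obtain k where k: "\<And>t. d t = k"
    using has_vector_derivative_zero_constant[of UNIV d] by auto
  have "d t = c 0"
    using k[of t] k[of 0] by (simp add: d_def)
  moreover have "?E t ** d t ** ?E (- t) = c t"
    \<comment> \<open>The left pair of rotors cancels when products are bracketed to the left, the
      right pair only when they are bracketed to the right.\<close>
    by (simp add: d_def matrix_mul_assoc rotor_minus[OF A \<omega>])
      (simp add: rotor_minus[OF A \<omega>] flip: matrix_mul_assoc)
  ultimately show ?thesis by simp
qed

section \<open>Periods, and the frequency of an element of su(2)\<close>

lemma rotor_half_period:
  assumes "\<omega> \<noteq> 0"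
  shows "rotor \<omega> A (t + pi / \<omega>) = - rotor \<omega> A t" "rotor \<omega> A (t - pi / \<omega>) = - rotor \<omega> A t"
  using assms
  by (simp_all add: rotor_def distrib_left right_diff_distrib sin_diff cos_diff)

lemma has_period_rotor_conjugation:
  fixes A g :: "complex^'n^'n"
  assumes A: "A ** A = - (\<omega>\<^sup>2 *\<^sub>R mat 1)" and \<omega>: "\<omega> > 0" and ne: "A ** g \<noteq> g ** A"
  shows "has_period (\<lambda>t. rotor \<omega> A t ** g ** rotor \<omega> A (- t)) (pi / \<omega>)"
  unfolding has_period_def
proof (intro conjI allI impI)
  have \<omega>': "\<omega> \<noteq> 0" using \<omega> by simp
  show "pi / \<omega> > 0" using \<omega> by simp
  show "rotor \<omega> A (t + pi / \<omega>) ** g ** rotor \<omega> A (- (t + pi / \<omega>)) =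
    rotor \<omega> A t ** g ** rotor \<omega> A (- t)" for t
    \<comment> \<open>Time runs backwards in the right factor, hence the second equation.\<close>
    using rotor_half_period(1)[OF \<omega>', of A t] rotor_half_period(2)[OF \<omega>', of A "- t"]
    by (simp add: mmult.minus_left mmult.minus_right)
  fix s :: real
  assume "s > 0" and per: "\<forall>t. rotor \<omega> A (t + s) ** g ** rotor \<omega> A (- (t + s)) =
    rotor \<omega> A t ** g ** rotor \<omega> A (- t)"
  from per[rule_format, of 0] have "rotor \<omega> A s ** g ** rotor \<omega> A (- s) = g"
    by simp
  then have "rotor \<omega> A s ** g = g ** rotor \<omega> A s"
    using rotor_minus(1)[OF A \<omega>'] by (metis matrix_mul_assoc matrix_mul_rid)
  \<comment> \<open>The scalar parts of the rotor commute with \<open>g\<close> and drop out. As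
    \<open>A\<close> and \<open>g\<close> do not commute, the remaining coefficient has to
    vanish.\<close>
  then have "(sin (\<omega> * s) / \<omega>) *\<^sub>R (A ** g) = (sin (\<omega> * s) / \<omega>) *\<^sub>R (g ** A)"
    by (simp add: rotor_def mmult.add_left mmult.add_right mmult.scaleR_left mmult.scaleR_right)
  then have "sin (\<omega> * s) = 0"
    using ne \<omega> by simp
  then have "\<not> \<omega> * s < pi"
    using sin_gt_zero[of "\<omega> * s"] \<omega> \<open>s > 0\<close> by auto
  then show "pi / \<omega> \<le> s"
    using \<omega> by (simp add: field_simps)
qed

text \<open>The trace is zero, so by Cayley--Hamilton the square is minus the determinant times the
  identity, and the determinant is a quarter of the sum of the squares of \<open>x\<close>,
  \<open>y\<close>, \<open>z\<close>.\<close>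

lemma su2_matrix_square:
  "su2_matrix x y z ** su2_matrix x y z = - ((sqrt (x\<^sup>2 + y\<^sup>2 + z\<^sup>2) / 2)\<^sup>2 *\<^sub>R mat 1)"
  by (simp add: su2_matrix_def vec_eq_iff forall_2 matrix_matrix_mult_def sum_2 mat_def
      power_divide complex_eq_iff) (simp add: power2_eq_square field_simps)

lemma su2_matrix_0: "su2_matrix 0 0 0 = 0"
  by (simp add: su2_matrix_def vec_eq_iff forall_2)

lemma has_period_imp_periodic_curve: "has_period c T \<Longrightarrow> periodic_curve c"
  by (auto simp: has_period_def periodic_curve_def)

section \<open>Orbits of the invariant and of the linear flow\<close>

theorem proposition5p3:
  fixes V :: "complex^2^2 \<Rightarrow> complex^2^2"
    and \<phi> :: "real \<Rightarrow> complex^2^2 \<Rightarrow> complex^2^2"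
    and X :: "complex^2^2"
    and x y z :: real
  assumes "linear_vector_field_with_flow SU2 V \<phi>"
    and "associated_field V X"
    and "X = su2_matrix x y z"
  shows "(\<forall>g\<in>carrier SU2. \<not> fixed_point (invariant_flow X) g \<longrightarrow>
            periodic_curve (orbit_curve (invariant_flow X) g))
       \<and> (\<forall>g\<in>carrier SU2. \<not> fixed_point \<phi> g \<longrightarrow> periodic_curve (orbit_curve \<phi> g))
       \<and> (\<forall>g\<in>carrier SU2. \<not> fixed_point \<phi> g \<longrightarrow>
            has_period (orbit_curve \<phi> g) (2 * pi / sqrt (x\<^sup>2 + y\<^sup>2 + z\<^sup>2)))"
proof (cases "x = 0 \<and> y = 0 \<and> z = 0")
  \<comment> \<open>For the zero matrix all orbits in the group are fixed points of both flows, so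
    the three claims hold vacuously.\<close>
  case True
  then have X: "X = 0"
    using assms(3) su2_matrix_0 by simp
  have "fixed_point (invariant_flow X) g" for g
    by (simp add: fixed_point_def invariant_flow_def X mat_exp_0)
  moreover have "fixed_point \<phi> g" if g: "g \<in> carrier SU2" for g
  proof -
    have flow: "\<phi> 0 g = g" "\<And>t. \<phi> t g \<in> carrier SU2"
      "\<And>t. ((\<lambda>s. \<phi> s g) has_vector_derivative V (\<phi> t g)) (at t)"
      using assms(1) g by (auto simp: linear_vector_field_with_flow_def flow_of_def)
    have "((\<lambda>s. \<phi> s g) has_vector_derivative 0) (at t)" for t
      using flow(3)[of t] associated_field_eq_commutator[OF assms(2) flow(2)] by (simp add: X)
    then obtain k where "\<And>t. \<phi> t g = k"
      using has_vector_derivative_zero_constant[of UNIV "\<lambda>s. \<phi> s g"] by auto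
    then show ?thesis
      using flow(1) by (simp add: fixed_point_def)
  qed
  ultimately show ?thesis by blast
next
  case False
  define \<omega> where "\<omega> = sqrt (x\<^sup>2 + y\<^sup>2 + z\<^sup>2) / 2"
  have "x\<^sup>2 + y\<^sup>2 + z\<^sup>2 > 0"
    using False by (auto simp: add_pos_nonneg add_nonneg_pos)
  then have \<omega>: "\<omega> > 0" "\<omega> \<noteq> 0"
    by (simp_all add: \<omega>_def)
  have X: "X ** X = - (\<omega>\<^sup>2 *\<^sub>R mat 1)"
    unfolding assms(3) \<omega>_def by (rule su2_matrix_square)
  have "periodic_curve (orbit_curve (invariant_flow X) g)" for g
    unfolding periodic_curve_def
  proof (intro exI conjI allI)
    \<comment> \<open>Under left multiplication alone the sign change after
      \<open>pi / \<omega>\<close> does not cancel, so two half periods are taken.\<close>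
    show "2 * (pi / \<omega>) > 0" using \<omega> by simp
    show "orbit_curve (invariant_flow X) g (t + 2 * (pi / \<omega>)) = orbit_curve (invariant_flow X) g t"
      for t
      using rotor_half_period(1)[OF \<omega>(2), of X "t + pi / \<omega>"] rotor_half_period(1)[OF \<omega>(2), of X t]
      by (simp add: orbit_curve_def invariant_flow_def mat_exp_eq_rotor[OF X \<omega>(2)] add.assoc)
  qed
  moreover have "has_period (orbit_curve \<phi> g) (2 * pi / sqrt (x\<^sup>2 + y\<^sup>2 + z\<^sup>2))"
    if g: "g \<in> carrier SU2" and nf: "\<not> fixed_point \<phi> g" for g
  proof -
    have flow: "\<phi> 0 g = g" "\<And>t. \<phi> t g \<in> carrier SU2"
      "\<And>t. ((\<lambda>s. \<phi> s g) has_vector_derivative V (\<phi> t g)) (at t)"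
      using assms(1) g by (auto simp: linear_vector_field_with_flow_def flow_of_def)
    \<comment> \<open>The commutator form of \<open>V\<close> holds on the group only; it applies
      along the whole orbit because the flow stays in \<open>SU2\<close>.\<close>
    have sol: "\<phi> t g = rotor \<omega> X t ** g ** rotor \<omega> X (- t)" for t
      using commutator_ode_solution[OF X \<omega>(2), of "\<lambda>s. \<phi> s g" t] flow(3)
        associated_field_eq_commutator[OF assms(2) flow(2)] by (simp add: flow(1))
    \<comment> \<open>If \<open>g\<close> commuted with \<open>X\<close>, it would commute with
      every rotor and be fixed by the conjugation.\<close>
    have "X ** g \<noteq> g ** X"
    proof
      assume comm: "X ** g = g ** X"
      then have "rotor \<omega> X t ** g = g ** rotor \<omega> X t" for t
        by (simp add: rotor_def mmult.add_left mmult.add_right mmult.scaleR_left mmult.scaleR_right)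
      then have "\<phi> t g = g" for t
        using rotor_minus(2)[OF X \<omega>(2), of t] by (simp add: sol flip: matrix_mul_assoc)
      then show False
        using nf by (simp add: fixed_point_def)
    qed
    from has_period_rotor_conjugation[OF X \<omega>(1) this] show ?thesis
      by (simp add: orbit_curve_def[abs_def] sol \<omega>_def mult.commute)
  qed
  ultimately show ?thesis
    using has_period_imp_periodic_curve by blast
qed

end
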